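(* Let $X$ be a Banach space over $\mathbb K\in\{\mathbb R,\mathbb C\}$ with dimension $1\le d<+\infty$, let $1\le p<+\infty$, and let $\mathcal S=(S_n)_{n\in\mathbb Z}$ be a sequence of invertible linear operators on $X$ for which there is $C>0$ with $\|S_n\|,\|S_n^{-1}\|<C$ for all $n\in\mathbb Z$. Suppose that $\mathcal S$ is jointly diagonalizable. Then the shift operator $\sigma_{\mathcal S}\colon\ell_p(X)\to\ell_p(X)$ is conjugate to the product of $d$ weighted backward shifts, each one defined on $\ell_p(\mathbb K)$.
   Context: $\ell_p(Y)$ is the Banach space of bilateral sequences $(y_n)_{n\in\mathbb Z}$ in $Y$ with $\|(y_n)\|_p=(\sum_{n\in\mathbb Z}\|y_n\|^p)^{1/p}<\infty$; finite products of copies of $\ell_p(\mathbb K)$ carry the sum norm. Shift operator: $\sigma_{\mathcal S}((x_n)_{n\in\mathbb Z})=(S_{n+1}(x_{n+1}))_{n\in\mathbb Z}$. For a sequence $\omega=(\omega_n)_{n\in\mathbb Z}$ of scalars bounded and bounded away from $0$, the weighted backward shift on $\ell_p(\mathbb K)$ is $B_\omega((t_n)_{n\in\mathbb Z})=(\omega_{n+1}t_{n+1})_{n\in\mathbb Z}$. Jointly diagonalizable: there is an invertible linear operator $\mathcal L\colon X\to X$ such that for every $n\in\mathbb Z$ there is a diagonal operator $D_n$ on $X$ (diagonal with respect to a basis of $X$ fixed once and for all, independent of $n$) with $S_n=\mathcal L D_n\mathcal L^{-1}$. Conjugate: bounded linear operators $T\colon Y\to Y$ and $R\colon Z\to Z$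 on Banach spaces are conjugate if there is a bounded invertible linear operator (with bounded inverse) $H\colon Y\to Z$ with $H\circ T=R\circ H$. *)

theory Defs
  imports "HOL-Analysis.Analysis"
begin

text \<open>
  The scalar field is \<open>\<real>\<close> or \<open>\<complex>\<close>: a multiplicative norm extending the absolute value of
  \<open>\<real>\<close> is unique on both, so the axiom determines the scalars up to isometric isomorphism.
  The parent class \<open>heine_borel\<close> is implied by the axiom; it only makes the library's
  completeness and compactness results available.
\<close>

class real_or_complex = real_normed_field + heine_borel +
  assumes real_or_complex:
    "(\<forall>z. \<exists>a. z = a *\<^sub>R 1) \<or>
     (\<exists>i. i * i = - 1 \<and> (\<forall>z. \<exists>a b. z = a *\<^sub>R 1 + b *\<^sub>R i))"

instance real :: real_or_complex
  by standard simp

instance complex :: real_or_complex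
proof
  have "z = Re z *\<^sub>R 1 + Im z *\<^sub>R \<i>" for z
    by (simp add: complex_eq_iff)
  then have "\<i> * \<i> = - 1 \<and> (\<forall>z. \<exists>a b. z = a *\<^sub>R 1 + b *\<^sub>R \<i>)"
    by auto
  then show "(\<forall>z::complex. \<exists>a. z = a *\<^sub>R 1) \<or>
      (\<exists>i::complex. i * i = - 1 \<and> (\<forall>z. \<exists>a b. z = a *\<^sub>R 1 + b *\<^sub>R i))"
    by blast
qed

text \<open>
  A Banach space over the scalar field. The type class \<open>banach\<close> supplies the norm, its
  completeness and the underlying real structure, which \<open>smul\<close> extends.
\<close>

locale banach_space_over = vector_space smul
  for smul :: "'k::real_or_complex \<Rightarrow> 'x::banach \<Rightarrow> 'x" +
  assumes norm_scale: "norm (smul c x) = norm c * norm x"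
    and scale_of_real: "smul (of_real r) x = r *\<^sub>R x"

definition basis_of :: "('k::field \<Rightarrow> 'x::ab_group_add \<Rightarrow> 'x) \<Rightarrow> 'x set \<Rightarrow> bool" where
  "basis_of smul E \<longleftrightarrow> \<not> module.dependent smul E \<and> module.span smul E = UNIV"

definition diagonal_operator ::
    "('k::field \<Rightarrow> 'x::ab_group_add \<Rightarrow> 'x) \<Rightarrow> 'x set \<Rightarrow> ('x \<Rightarrow> 'x) \<Rightarrow> bool" where
  "diagonal_operator smul E D \<longleftrightarrow>
     Vector_Spaces.linear smul smul D \<and> (\<forall>e\<in>E. \<exists>c. D e = smul c e)"

definition jointly_diagonalizable ::
    "('k::field \<Rightarrow> 'x::ab_group_add \<Rightarrow> 'x) \<Rightarrow> 'x set \<Rightarrow> (int \<Rightarrow> 'x \<Rightarrow> 'x) \<Rightarrow> bool" where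
  "jointly_diagonalizable smul E S \<longleftrightarrow>
     (\<exists>L. Vector_Spaces.linear smul smul L \<and> bij L \<and>
        (\<forall>n. \<exists>D. diagonal_operator smul E D \<and> S n = L \<circ> D \<circ> inv L))"

text \<open>
  Sequence spaces depend on the real number \<open>p\<close>, so they are normed spaces with an explicit
  carrier rather than types. Operators are compared on carriers only.
\<close>

record ('k, 'v) nspace =
  vectors :: "'v set"
  plus_in :: "'v \<Rightarrow> 'v \<Rightarrow> 'v"
  scale_in :: "'k \<Rightarrow> 'v \<Rightarrow> 'v"
  norm_in :: "'v \<Rightarrow> real"

definition bounded_operator ::
    "('k, 'v) nspace \<Rightarrow> ('k, 'w) nspace \<Rightarrow> ('v \<Rightarrow> 'w) \<Rightarrow> bool" where
  "bounded_operator V W T \<longleftrightarrow>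
     T \<in> vectors V \<rightarrow> vectors W \<and>
     (\<forall>u\<in>vectors V. \<forall>v\<in>vectors V. T (plus_in V u v) = plus_in W (T u) (T v)) \<and>
     (\<forall>c. \<forall>v\<in>vectors V. T (scale_in V c v) = scale_in W c (T v)) \<and>
     (\<exists>M. \<forall>v\<in>vectors V. norm_in W (T v) \<le> M * norm_in V v)"

definition conjugate ::
    "('k, 'v) nspace \<Rightarrow> ('v \<Rightarrow> 'v) \<Rightarrow> ('k, 'w) nspace \<Rightarrow> ('w \<Rightarrow> 'w) \<Rightarrow> bool" where
  "conjugate V T W R \<longleftrightarrow>
     bounded_operator V V T \<and> bounded_operator W W R \<and>
     (\<exists>H G. bounded_operator V W H \<and> bounded_operator W V G \<and>
        (\<forall>v\<in>vectors V. G (H v) = v) \<and> (\<forall>w\<in>vectors W. H (G w) = w) \<and>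
        (\<forall>v\<in>vectors V. H (T v) = R (H v)))"

definition lp_space ::
    "('k \<Rightarrow> 'y::real_normed_vector \<Rightarrow> 'y) \<Rightarrow> real \<Rightarrow> ('k, int \<Rightarrow> 'y) nspace" where
  "lp_space smul p =
     \<lparr>vectors = {y. (\<lambda>n. norm (y n) powr p) summable_on UNIV},
      plus_in = (\<lambda>y z n. y n + z n),
      scale_in = (\<lambda>c y n. smul c (y n)),
      norm_in = (\<lambda>y. (\<Sum>\<^sub>\<infinity>n. norm (y n) powr p) powr (1 / p))\<rparr>"

definition power_space :: "nat \<Rightarrow> ('k, 'v) nspace \<Rightarrow> ('k, nat \<Rightarrow> 'v) nspace" where
  "power_space d V =
     \<lparr>vectors = {..<d} \<rightarrow>\<^sub>E vectors V,
      plus_in = (\<lambda>f g. \<lambda>i\<in>{..<d}. plus_in V (f i) (g i)),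
      scale_in = (\<lambda>c f. \<lambda>i\<in>{..<d}. scale_in V c (f i)),
      norm_in = (\<lambda>f. \<Sum>i<d. norm_in V (f i))\<rparr>"

definition product_operator :: "nat \<Rightarrow> (nat \<Rightarrow> 'v \<Rightarrow> 'v) \<Rightarrow> (nat \<Rightarrow> 'v) \<Rightarrow> (nat \<Rightarrow> 'v)" where
  "product_operator d T f = (\<lambda>i\<in>{..<d}. T i (f i))"

definition shift_operator :: "(int \<Rightarrow> 'x \<Rightarrow> 'x) \<Rightarrow> (int \<Rightarrow> 'x) \<Rightarrow> (int \<Rightarrow> 'x)" where
  "shift_operator S x = (\<lambda>n. S (n + 1) (x (n + 1)))"

definition weight_sequence :: "(int \<Rightarrow> 'k::real_normed_field) \<Rightarrow> bool" where
  "weight_sequence w \<longleftrightarrow> (\<exists>a>0. \<exists>M. \<forall>n. a \<le> norm (w n) \<and> norm (w n) \<le> M)"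

definition weighted_backward_shift ::
    "(int \<Rightarrow> 'k::real_normed_field) \<Rightarrow> (int \<Rightarrow> 'k) \<Rightarrow> (int \<Rightarrow> 'k)" where
  "weighted_backward_shift w t = (\<lambda>n. w (n + 1) * t (n + 1))"

end

theory Submission
  imports Defs
begin

text \<open>
  The operators \<open>S n\<close> have a common eigenbasis: if \<open>S n = L \<circ> D n \<circ> inv L\<close> with \<open>D n\<close> diagonal
  with respect to \<open>E\<close>, then every vector of \<open>L ` E\<close> is an eigenvector of every \<open>S n\<close>. Let
  \<open>h 0, \<dots>, h (d - 1)\<close> enumerate \<open>L ` E\<close>, and let \<open>w i n\<close> be the eigenvalue of \<open>S n\<close> at \<open>h i\<close>.
  Reading a sequence in \<open>X\<close> through its coordinates with respect to this basis splits it into \<open>d\<close>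
  scalar sequences, and it turns \<open>S n\<close> into multiplication by \<open>w i n\<close> in the \<open>i\<close>-th coordinate,
  so that the shift operator becomes the product of the weighted backward shifts with weights
  \<open>w i\<close>.

  Two estimates make this a conjugacy of Banach space operators. First, the coordinate
  functionals of a finite basis are bounded (\<open>coordinates_bounded\<close>), so that the coordinate map
  of \<open>\<ell>\<^sub>p\<close> spaces and its inverse are bounded; they act term by term, and
  \<open>bounded_operator_termwise\<close> and \<open>bounded_operator_synthesis\<close> transfer the bounds to sequences.
  Secondly, testing \<open>S n\<close> and its inverse on \<open>h i\<close> gives \<open>1 / C \<le> norm (w i n) \<le> C\<close>.
\<close>

section \<open>Coordinates in a finite-dimensional normed space\<close>

context banach_space_over
begin

lemma bounded_linear_scale_left: "bounded_linear (\<lambda>c. smul c x)"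
proof (rule bounded_linear_intro)
  fix c c' r
  show "smul (c + c') x = smul c x + smul c' x"
    by (rule scale_left_distrib)
  show "smul (r *\<^sub>R c) x = r *\<^sub>R smul c x"
    by (simp add: scaleR_conv_of_real scale_of_real flip: scale_scale)
  show "norm (smul c x) \<le> norm c * norm x"
    by (simp add: norm_scale)
qed

text \<open>
  A Cauchy sequence in the span has Cauchy coordinates, whose limits are the coordinates of its
  limit.
\<close>

lemma closed_span_if_coordinates_bounded:
  assumes "finite B"
    and K: "\<And>c b. b \<in> B \<Longrightarrow> norm (c b) \<le> K * norm (\<Sum>v\<in>B. smul (c v) v)"
  shows "closed (span B)"
  unfolding closed_sequential_limits
proof (intro allI impI, elim conjE)
  fix x l
  assume "\<forall>n. x n \<in> span B" and l: "x \<longlonglongrightarrow> l"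
  then have "\<forall>n. \<exists>c. x n = (\<Sum>v\<in>B. smul (c v) v)"
    using \<open>finite B\<close> by (auto simp: span_finite)
  then obtain c where c: "\<And>n. x n = (\<Sum>v\<in>B. smul (c n v) v)"
    by metis
  have K': "norm (c m b - c n b) \<le> K * norm (x m - x n)" if "b \<in> B" for m n b
    using K[OF that, of "\<lambda>v. c m v - c n v"]
    by (simp add: c scale_left_diff_distrib sum_subtractf)
  have "convergent (\<lambda>n. c n b)" if "b \<in> B" for b
  proof (rule Cauchy_convergent, rule CauchyI)
    fix e :: real
    assume "e > 0"
    then obtain N where N: "\<And>m n. m \<ge> N \<Longrightarrow> n \<ge> N \<Longrightarrow> norm (x m - x n) < e / (\<bar>K\<bar> + 1)"
      using CauchyD[OF LIMSEQ_imp_Cauchy[OF l], of "e / (\<bar>K\<bar> + 1)"]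
      by (meson abs_ge_zero add_nonneg_pos divide_pos_pos zero_less_one)
    have "norm (c m b - c n b) < e" if "m \<ge> N" "n \<ge> N" for m n
    proof -
      have "norm (c m b - c n b) \<le> (\<bar>K\<bar> + 1) * norm (x m - x n)"
        by (rule order_trans[OF K'[OF \<open>b \<in> B\<close>]]) (simp add: mult_right_mono)
      also have "\<dots> < e"
        using N[OF that] by (simp add: pos_less_divide_eq mult.commute add_nonneg_pos)
      finally show ?thesis .
    qed
    then show "\<exists>N. \<forall>m\<ge>N. \<forall>n\<ge>N. norm (c m b - c n b) < e"
      by blast
  qed
  then have "\<And>b. b \<in> B \<Longrightarrow> \<exists>a. (\<lambda>n. c n b) \<longlonglongrightarrow> a"
    by (simp add: convergent_def)
  then obtain a where a: "\<And>b. b \<in> B \<Longrightarrow> (\<lambda>n. c n b) \<longlonglongrightarrow> a b"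
    by metis
  have "x \<longlonglongrightarrow> (\<Sum>v\<in>B. smul (a v) v)"
    unfolding c by (intro tendsto_sum bounded_linear.tendsto[OF bounded_linear_scale_left] a)
  then have "l = (\<Sum>v\<in>B. smul (a v) v)"
    using l LIMSEQ_unique by blast
  then show "l \<in> span B"
    by (simp add: span_sum span_scale span_base)
qed

text \<open>
  Induction on the set: a further vector \<open>b\<close> has a positive distance \<open>\<delta>\<close> to the span of the
  others, since that span is closed, and so its coordinate in \<open>x\<close> is at most \<open>norm x / \<delta>\<close>. The
  other coordinates belong to \<open>x\<close> minus its \<open>b\<close>-component, which lies in the smaller span and
  whose norm is at most a multiple of \<open>norm x\<close>.
\<close>

lemma independent_coefficients_bounded:
  assumes "finite B" and "independent B"
  shows "\<exists>K\<ge>0. \<forall>c. \<forall>b\<in>B. norm (c b) \<le> K * norm (\<Sum>v\<in>B. smul (c v) v)"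
  using assms
proof (induction B rule: finite_induct)
  case empty
  show ?case
    by auto
next
  case (insert b B)
  have indep: "independent B" and "b \<notin> span B"
    using insert.hyps insert.prems by (metis independent_insert)+
  obtain K where "K \<ge> 0"
    and K: "\<And>c v. v \<in> B \<Longrightarrow> norm (c v) \<le> K * norm (\<Sum>v\<in>B. smul (c v) v)"
    using insert.IH[OF indep] by blast
  have "closed (span B)"
    using \<open>finite B\<close> K by (rule closed_span_if_coordinates_bounded)
  then obtain \<delta> where "\<delta> > 0" and "ball b \<delta> \<subseteq> - span B"
    using \<open>b \<notin> span B\<close> by (metis ComplI openE open_Compl)
  then have \<delta>: "\<delta> \<le> dist b y" if "y \<in> span B" for y
    using that by (meson ComplD mem_ball not_le subsetD)
  let ?K = "1 / \<delta> + K * (1 + norm b / \<delta>)"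
  have "norm (c v) \<le> ?K * norm (\<Sum>v\<in>insert b B. smul (c v) v)" if v: "v \<in> insert b B" for c v
  proof -
    define y where "y = (\<Sum>v\<in>B. smul (c v) v)"
    define x where "x = (\<Sum>v\<in>insert b B. smul (c v) v)"
    have x: "x = smul (c b) b + y"
      using insert.hyps by (simp add: x_def y_def)
    have "y \<in> span B"
      unfolding y_def by (intro span_sum span_scale span_base)
    have cb: "norm (c b) \<le> norm x / \<delta>"
    proof (cases "c b = 0")
      case True
      then show ?thesis
        using \<open>\<delta> > 0\<close> by simp
    next
      case False
      have "x = smul (c b) (b - smul (- inverse (c b)) y)"
        using False by (simp add: x scale_right_diff_distrib scale_right_distrib)
      then have "norm x = norm (c b) * dist b (smul (- inverse (c b)) y)"
        by (simp only: norm_scale dist_norm)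
      moreover have "\<delta> \<le> dist b (smul (- inverse (c b)) y)"
        by (intro \<delta> span_scale \<open>y \<in> span B\<close>)
      ultimately have "norm (c b) * \<delta> \<le> norm x"
        by (simp add: mult_left_mono)
      then show ?thesis
        using \<open>\<delta> > 0\<close> by (simp add: pos_le_divide_eq)
    qed
    have pos: "0 \<le> 1 / \<delta> * norm x" "0 \<le> K * (1 + norm b / \<delta>) * norm x"
      using \<open>K \<ge> 0\<close> \<open>\<delta> > 0\<close> by simp_all
    have "norm (c v) \<le> 1 / \<delta> * norm x + K * (1 + norm b / \<delta>) * norm x"
    proof (cases "v = b")
      case True
      then show ?thesis
        using cb pos by simp
    next
      case False
      have "norm y = norm (x - smul (c b) b)"
        by (simp add: x)
      also have "\<dots> \<le> norm x + norm (c b) * norm b"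
        using norm_triangle_ineq4[of x "smul (c b) b"] by (simp add: norm_scale)
      also have "\<dots> \<le> norm x + norm x / \<delta> * norm b"
        by (intro add_left_mono mult_right_mono cb norm_ge_zero)
      finally have "norm y \<le> (1 + norm b / \<delta>) * norm x"
        by (simp add: algebra_simps)
      then have "K * norm y \<le> K * (1 + norm b / \<delta>) * norm x"
        using \<open>K \<ge> 0\<close> by (simp add: mult.assoc mult_left_mono)
      moreover have "norm (c v) \<le> K * norm y"
        unfolding y_def using K False v by blast
      ultimately show ?thesis
        using pos by linarith
    qed
    then show ?thesis
      unfolding x_def by (simp add: distrib_right)
  qed
  moreover have "?K \<ge> 0"
    using \<open>K \<ge> 0\<close> \<open>\<delta> > 0\<close> by simp
  ultimately show ?case
    by blast
qed

lemma coordinates_bounded: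
  assumes "finite B" and "independent B" and "span B = UNIV"
  shows "\<exists>K\<ge>0. \<forall>x. \<forall>b\<in>B. norm (representation B x b) \<le> K * norm x"
proof -
  have "(\<Sum>b\<in>B. smul (representation B x b) b) = x" for x
    using assms by (intro sum_representation_eq) auto
  then show ?thesis
    using independent_coefficients_bounded[OF assms(1,2)] by metis
qed

lemma bounded_linear_finite_dimensional:
  assumes B: "finite B" "independent B" "span B = UNIV"
    and T: "Vector_Spaces.linear smul smul T"
  shows "bounded_linear T"
proof -
  interpret T: Vector_Spaces.linear smul smul T
    by (rule T)
  obtain K where K: "\<And>x b. b \<in> B \<Longrightarrow> norm (representation B x b) \<le> K * norm x"
    using coordinates_bounded[OF B] by blast
  show ?thesis
  proof (rule bounded_linear_intro)
    fix x y r
    show "T (x + y) = T x + T y"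
      by (rule T.add)
    show "T (r *\<^sub>R x) = r *\<^sub>R T x"
      using T.scale[of "of_real r" x] by (simp only: scale_of_real)
    have "(\<Sum>b\<in>B. smul (representation B x b) b) = x"
      using B by (intro sum_representation_eq) auto
    then have "T x = (\<Sum>b\<in>B. smul (representation B x b) (T b))"
      by (metis (no_types, lifting) T.sum T.scale sum.cong)
    also have "norm \<dots> \<le> (\<Sum>b\<in>B. K * norm x * norm (T b))"
      by (intro sum_norm_le) (simp add: norm_scale mult_right_mono K)
    also have "\<dots> = norm x * (\<Sum>b\<in>B. K * norm (T b))"
      by (simp add: sum_distrib_left mult_ac)
    finally show "norm (T x) \<le> norm x * (\<Sum>b\<in>B. K * norm (T b))" .
  qed
qed

end

section \<open>Operators on sequence spaces and their powers\<close>

lemma has_sum_finite_sum: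
  fixes f :: "'i \<Rightarrow> 'a \<Rightarrow> 'b::topological_comm_monoid_add"
  assumes "finite I" and "\<And>i. i \<in> I \<Longrightarrow> (f i has_sum s i) A"
  shows "((\<lambda>x. \<Sum>i\<in>I. f i x) has_sum (\<Sum>i\<in>I. s i)) A"
  using assms by (induction I rule: finite_induct) (auto intro: has_sum_add)

lemma norm_in_lp_nonneg: "0 \<le> norm_in (lp_space smul p) y"
  by (simp add: lp_space_def)

lemma lp_space_dominated:
  fixes y :: "int \<Rightarrow> 'y::real_normed_vector" and z :: "int \<Rightarrow> 'z::real_normed_vector"
  assumes "1 \<le> p" and "0 \<le> M" and y: "y \<in> vectors (lp_space smul p)"
    and z: "\<And>n. norm (z n) \<le> M * norm (y (n + k))"
  shows "z \<in> vectors (lp_space smul' p)"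
    and "norm_in (lp_space smul' p) z \<le> M * norm_in (lp_space smul p) y"
proof -
  have bij: "bij_betw (\<lambda>n. n + k) (UNIV :: int set) UNIV"
    by (rule bij_betw_byWitness[where f' = "\<lambda>n. n - k"]) auto
  have sy: "(\<lambda>n. norm (y n) powr p) summable_on UNIV"
    using y by (simp add: lp_space_def)
  then have "(\<lambda>n. norm (y (n + k)) powr p) summable_on UNIV"
    using summable_on_reindex_bij_betw[OF bij, of "\<lambda>n. norm (y n) powr p"] by simp
  then have sM: "(\<lambda>n. M powr p * norm (y (n + k)) powr p) summable_on UNIV"
    by (rule summable_on_cmult_right)
  have le: "norm (z n) powr p \<le> M powr p * norm (y (n + k)) powr p" for n
    using powr_mono2[OF _ _ z[of n], of p] \<open>1 \<le> p\<close> \<open>0 \<le> M\<close> by (simp add: powr_mult)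
  have sz: "(\<lambda>n. norm (z n) powr p) summable_on UNIV"
    by (rule summable_on_comparison_test[OF sM]) (use le in auto)
  then show "z \<in> vectors (lp_space smul' p)"
    by (simp add: lp_space_def)
  have "(\<Sum>\<^sub>\<infinity>n. norm (z n) powr p) \<le> (\<Sum>\<^sub>\<infinity>n. M powr p * norm (y (n + k)) powr p)"
    by (intro infsum_mono sz sM le)
  also have "\<dots> = M powr p * (\<Sum>\<^sub>\<infinity>n. norm (y (n + k)) powr p)"
    by (rule infsum_cmult_right')
  also have "(\<Sum>\<^sub>\<infinity>n. norm (y (n + k)) powr p) = (\<Sum>\<^sub>\<infinity>n. norm (y n) powr p)"
    using infsum_reindex_bij_betw[OF bij, of "\<lambda>n. norm (y n) powr p"] by simp
  finally have "(\<Sum>\<^sub>\<infinity>n. norm (z n) powr p) powr (1 / p)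
      \<le> (M powr p * (\<Sum>\<^sub>\<infinity>n. norm (y n) powr p)) powr (1 / p)"
    using \<open>1 \<le> p\<close> by (intro powr_mono2 infsum_nonneg) auto
  also have "\<dots> = M * (\<Sum>\<^sub>\<infinity>n. norm (y n) powr p) powr (1 / p)"
    using \<open>1 \<le> p\<close> \<open>0 \<le> M\<close> by (subst powr_mult) (auto intro: infsum_nonneg simp: powr_powr)
  finally show "norm_in (lp_space smul' p) z \<le> M * norm_in (lp_space smul p) y"
    by (simp add: lp_space_def)
qed

text \<open>
  With \<open>k = 1\<close> this covers shifts, and with \<open>k = 0\<close> maps that act on each term of a sequence.
\<close>

lemma bounded_operator_termwise:
  fixes A :: "int \<Rightarrow> 'y::real_normed_vector \<Rightarrow> 'z::real_normed_vector"
  assumes "1 \<le> p" and "0 \<le> M"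
    and "\<And>n x y. A n (x + y) = A n x + A n y"
    and "\<And>n c x. A n (smul c x) = smul' c (A n x)"
    and "\<And>n x. norm (A n x) \<le> M * norm x"
  shows "bounded_operator (lp_space smul p) (lp_space smul' p) (\<lambda>y n. A n (y (n + k)))"
proof -
  have "(\<lambda>n. A n (y (n + k))) \<in> vectors (lp_space smul' p)"
    "norm_in (lp_space smul' p) (\<lambda>n. A n (y (n + k))) \<le> M * norm_in (lp_space smul p) y"
    if "y \<in> vectors (lp_space smul p)" for y
    using lp_space_dominated[OF assms(1,2) that, where z = "\<lambda>n. A n (y (n + k))"] assms(5)
    by blast+
  then show ?thesis
    unfolding bounded_operator_def using assms(3,4) by (auto simp: lp_space_def)
qed

text \<open>
  Up to a constant depending on \<open>d\<close> and \<open>p\<close> this is Minkowski's inequality. The constant is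
  harmless, and with it the bound follows from estimating each term by the largest summand.
\<close>

lemma lp_space_sum:
  fixes y :: "nat \<Rightarrow> int \<Rightarrow> 'y::real_normed_vector"
  assumes "1 \<le> p" and y: "\<And>i. i < d \<Longrightarrow> y i \<in> vectors (lp_space smul p)"
  shows "(\<lambda>n. \<Sum>i<d. y i n) \<in> vectors (lp_space smul p)"
    and "norm_in (lp_space smul p) (\<lambda>n. \<Sum>i<d. y i n)
      \<le> real d * real d powr (1 / p) * (\<Sum>i<d. norm_in (lp_space smul p) (y i))"
proof -
  define N where "N i = (\<Sum>\<^sub>\<infinity>n. norm (y i n) powr p)" for i
  have s: "(\<lambda>n. norm (y i n) powr p) summable_on UNIV" if "i < d" for i
    using y[OF that] by (simp add: lp_space_def)
  have sN: "((\<lambda>n. \<Sum>i<d. norm (y i n) powr p) has_sum (\<Sum>i<d. N i)) UNIV"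
    unfolding N_def by (intro has_sum_finite_sum has_sum_infsum s) auto
  then have sd: "(\<lambda>n. \<Sum>i<d. norm (y i n) powr p) summable_on UNIV"
    by (rule has_sum_imp_summable)
  then have sdp: "(\<lambda>n. real d powr p * (\<Sum>i<d. norm (y i n) powr p)) summable_on UNIV"
    by (rule summable_on_cmult_right)
  have le: "norm (\<Sum>i<d. y i n) powr p \<le> real d powr p * (\<Sum>i<d. norm (y i n) powr p)" for n
  proof (cases "d = 0")
    case False
    define m where "m = Max ((\<lambda>i. norm (y i n)) ` {..<d})"
    have "m \<in> (\<lambda>i. norm (y i n)) ` {..<d}"
      unfolding m_def using False by (intro Max_in) auto
    then obtain j where j: "j < d" "m = norm (y j n)"
      by auto
    have "norm (\<Sum>i<d. y i n) \<le> (\<Sum>i<d. m)"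
      by (intro sum_norm_le) (simp add: m_def)
    then have "norm (\<Sum>i<d. y i n) powr p \<le> (real d * m) powr p"
      using \<open>1 \<le> p\<close> by (intro powr_mono2) auto
    also have "\<dots> = real d powr p * norm (y j n) powr p"
      by (simp add: j powr_mult)
    also have "\<dots> \<le> real d powr p * (\<Sum>i<d. norm (y i n) powr p)"
      using j member_le_sum[of j "{..<d}" "\<lambda>i. norm (y i n) powr p"]
      by (intro mult_left_mono) auto
    finally show ?thesis .
  qed simp
  have sy: "(\<lambda>n. norm (\<Sum>i<d. y i n) powr p) summable_on UNIV"
    by (rule summable_on_comparison_test[OF sdp]) (use le in auto)
  then show "(\<lambda>n. \<Sum>i<d. y i n) \<in> vectors (lp_space smul p)"
    by (simp add: lp_space_def)
  define A where "A = (\<Sum>i<d. N i powr (1 / p))"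
  have N0: "N i \<ge> 0" for i
    unfolding N_def by (intro infsum_nonneg) auto
  have "A \<ge> 0"
    unfolding A_def by (intro sum_nonneg) auto
  have NA: "N i \<le> A powr p" if "i < d" for i
  proof -
    have "N i powr (1 / p) \<le> A"
      unfolding A_def using that by (intro member_le_sum) auto
    then have "(N i powr (1 / p)) powr p \<le> A powr p"
      using \<open>1 \<le> p\<close> by (intro powr_mono2) auto
    then show ?thesis
      using \<open>1 \<le> p\<close> N0 by (simp add: powr_powr)
  qed
  have "(\<Sum>\<^sub>\<infinity>n. norm (\<Sum>i<d. y i n) powr p)
      \<le> (\<Sum>\<^sub>\<infinity>n. real d powr p * (\<Sum>i<d. norm (y i n) powr p))"
    by (intro infsum_mono sy sdp le)
  also have "\<dots> = real d powr p * (\<Sum>\<^sub>\<infinity>n. \<Sum>i<d. norm (y i n) powr p)"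
    by (rule infsum_cmult_right')
  also have "(\<Sum>\<^sub>\<infinity>n. \<Sum>i<d. norm (y i n) powr p) = (\<Sum>i<d. N i)"
    using sN by (rule infsumI)
  also have "(\<Sum>i<d. N i) \<le> (\<Sum>i<d. A powr p)"
    by (intro sum_mono NA) simp
  finally have "(\<Sum>\<^sub>\<infinity>n. norm (\<Sum>i<d. y i n) powr p) powr (1 / p)
      \<le> (real d powr p * (real d * A powr p)) powr (1 / p)"
    using \<open>1 \<le> p\<close> by (intro powr_mono2 infsum_nonneg) (auto simp: mult_left_mono)
  also have "\<dots> = real d * real d powr (1 / p) * A"
    using \<open>1 \<le> p\<close> \<open>A \<ge> 0\<close> by (simp add: powr_mult powr_powr)
  finally show "norm_in (lp_space smul p) (\<lambda>n. \<Sum>i<d. y i n)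
      \<le> real d * real d powr (1 / p) * (\<Sum>i<d. norm_in (lp_space smul p) (y i))"
    by (simp add: lp_space_def A_def N_def)
qed

lemma bounded_operator_nonneg_bound:
  assumes "bounded_operator V W T" and "\<And>v. v \<in> vectors V \<Longrightarrow> 0 \<le> norm_in V v"
  shows "\<exists>M\<ge>0. \<forall>v\<in>vectors V. norm_in W (T v) \<le> M * norm_in V v"
proof -
  obtain M where M: "\<And>v. v \<in> vectors V \<Longrightarrow> norm_in W (T v) \<le> M * norm_in V v"
    using assms(1) unfolding bounded_operator_def by blast
  have "norm_in W (T v) \<le> \<bar>M\<bar> * norm_in V v" if "v \<in> vectors V" for v
    by (rule order_trans[OF M[OF that]]) (simp add: mult_right_mono assms(2) that)
  then show ?thesis
    using abs_ge_zero by blast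
qed

text \<open>
  One constant serves finitely many bounded operators at once; the sum of their bounds will do.
\<close>

lemma bounded_operators_common_bound:
  assumes "\<And>i. i < (d::nat) \<Longrightarrow> bounded_operator V W (T i)"
    and nonneg: "\<And>v. v \<in> vectors V \<Longrightarrow> 0 \<le> norm_in V v"
  shows "\<exists>M\<ge>0. \<forall>i<d. \<forall>v\<in>vectors V. norm_in W (T i v) \<le> M * norm_in V v"
proof -
  have "\<exists>M\<ge>0. \<forall>v\<in>vectors V. norm_in W (T i v) \<le> M * norm_in V v" if "i < d" for i
    using bounded_operator_nonneg_bound[OF assms(1)[OF that]] nonneg by blast
  then obtain M where M0: "\<And>i. i < d \<Longrightarrow> 0 \<le> M i"
    and M: "\<And>i v. i < d \<Longrightarrow> v \<in> vectors V \<Longrightarrow> norm_in W (T i v) \<le> M i * norm_in V v"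
    by metis
  have "norm_in W (T i v) \<le> (\<Sum>i<d. M i) * norm_in V v" if "i < d" "v \<in> vectors V" for i v
    by (rule order_trans[OF M[OF that]])
       (use that M0 nonneg in \<open>auto intro!: mult_right_mono member_le_sum\<close>)
  then show ?thesis
    using M0 by (intro exI[of _ "\<Sum>i<d. M i"]) (auto intro: sum_nonneg)
qed

lemma bounded_operator_into_power:
  assumes T: "\<And>i. i < d \<Longrightarrow> bounded_operator V W (T i)"
    and nonneg: "\<And>v. v \<in> vectors V \<Longrightarrow> 0 \<le> norm_in V v"
  shows "bounded_operator V (power_space d W) (\<lambda>v. \<lambda>i\<in>{..<d}. T i v)"
proof -
  obtain M where "M \<ge> 0"
    and M: "\<And>i v. i < d \<Longrightarrow> v \<in> vectors V \<Longrightarrow> norm_in W (T i v) \<le> M * norm_in V v"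
    using bounded_operators_common_bound[of d V W T] assms by metis
  have "(\<Sum>i<d. norm_in W (T i v)) \<le> real d * M * norm_in V v" if "v \<in> vectors V" for v
    using sum_bounded_above[of "{..<d}" "\<lambda>i. norm_in W (T i v)" "M * norm_in V v"] M that
    by (simp add: mult.assoc)
  moreover have "T i v \<in> vectors W" if "i < d" "v \<in> vectors V" for i v
    using T that unfolding bounded_operator_def by blast
  moreover have "T i (plus_in V u v) = plus_in W (T i u) (T i v)"
    if "i < d" "u \<in> vectors V" "v \<in> vectors V" for i u v
    using T that unfolding bounded_operator_def by blast
  moreover have "T i (scale_in V c v) = scale_in W c (T i v)"
    if "i < d" "v \<in> vectors V" for i c v
    using T that unfolding bounded_operator_def by blast
  ultimately show ?thesis
    unfolding bounded_operator_def power_space_def by (auto intro!: restrict_ext)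
qed

lemma bounded_operator_product:
  assumes T: "\<And>i. i < d \<Longrightarrow> bounded_operator V W (T i)"
    and nonneg: "\<And>v. v \<in> vectors V \<Longrightarrow> 0 \<le> norm_in V v"
  shows "bounded_operator (power_space d V) (power_space d W) (product_operator d T)"
proof -
  obtain M where "M \<ge> 0"
    and M: "\<And>i v. i < d \<Longrightarrow> v \<in> vectors V \<Longrightarrow> norm_in W (T i v) \<le> M * norm_in V v"
    using bounded_operators_common_bound[of d V W T] assms by metis
  have "(\<Sum>i<d. norm_in W (T i (f i))) \<le> M * (\<Sum>i<d. norm_in V (f i))"
    if "f \<in> {..<d} \<rightarrow>\<^sub>E vectors V" for f
    unfolding sum_distrib_left using that by (intro sum_mono M) auto
  moreover have "f i \<in> vectors V" if "f \<in> {..<d} \<rightarrow>\<^sub>E vectors V" "i < d" for f i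
    using that by auto
  moreover have "T i v \<in> vectors W" if "i < d" "v \<in> vectors V" for i v
    using T that unfolding bounded_operator_def by blast
  moreover have "T i (plus_in V u v) = plus_in W (T i u) (T i v)"
    if "i < d" "u \<in> vectors V" "v \<in> vectors V" for i u v
    using T that unfolding bounded_operator_def by blast
  moreover have "T i (scale_in V c v) = scale_in W c (T i v)"
    if "i < d" "v \<in> vectors V" for i c v
    using T that unfolding bounded_operator_def by blast
  ultimately show ?thesis
    unfolding bounded_operator_def power_space_def product_operator_def
    by (auto intro!: restrict_ext)
qed

lemma (in banach_space_over) bounded_operator_synthesis:
  assumes "1 \<le> p"
  shows "bounded_operator (power_space d (lp_space (*) p)) (lp_space smul p)
    (\<lambda>f n. \<Sum>i<d. smul (f i n) (h i))"
proof -
  let ?J = "\<lambda>i (t :: int \<Rightarrow> 'k) n. smul (t n) (h i)"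
  have J: "bounded_operator (lp_space (*) p) (lp_space smul p) (?J i)" for i
    using bounded_operator_termwise[of p "norm (h i)" "\<lambda>n t. smul t (h i)" "(*)" smul 0] assms
    by (simp add: scale_left_distrib norm_scale mult.commute)
  obtain M where "M \<ge> 0" and M: "\<And>i t. i < d \<Longrightarrow> t \<in> vectors (lp_space (*) p)
      \<Longrightarrow> norm_in (lp_space smul p) (?J i t) \<le> M * norm_in (lp_space (*) p) t"
    using bounded_operators_common_bound[of d _ _ ?J, OF J norm_in_lp_nonneg] by metis
  have Jv: "?J i t \<in> vectors (lp_space smul p)" if "t \<in> vectors (lp_space (*) p)" for i t
    using J that unfolding bounded_operator_def by blast
  let ?c = "real d * real d powr (1 / p)"
  have "(\<lambda>n. \<Sum>i<d. ?J i (f i) n) \<in> vectors (lp_space smul p)"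
    "norm_in (lp_space smul p) (\<lambda>n. \<Sum>i<d. ?J i (f i) n)
      \<le> ?c * M * (\<Sum>i<d. norm_in (lp_space (*) p) (f i))"
    if f: "f \<in> {..<d} \<rightarrow>\<^sub>E vectors (lp_space (*) p)" for f
  proof -
    have v: "?J i (f i) \<in> vectors (lp_space smul p)" if "i < d" for i
      using f that by (intro Jv) auto
    show "(\<lambda>n. \<Sum>i<d. ?J i (f i) n) \<in> vectors (lp_space smul p)"
      by (rule lp_space_sum[OF assms v])
    have "norm_in (lp_space smul p) (\<lambda>n. \<Sum>i<d. ?J i (f i) n)
      \<le> ?c * (\<Sum>i<d. norm_in (lp_space smul p) (?J i (f i)))"
      by (rule lp_space_sum[OF assms v])
    also have "\<dots> \<le> ?c * (\<Sum>i<d. M * norm_in (lp_space (*) p) (f i))"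
      using f by (intro mult_left_mono sum_mono M) auto
    finally show "norm_in (lp_space smul p) (\<lambda>n. \<Sum>i<d. ?J i (f i) n)
      \<le> ?c * M * (\<Sum>i<d. norm_in (lp_space (*) p) (f i))"
      by (simp add: sum_distrib_left mult_ac)
  qed
  moreover have "plus_in (lp_space smul p) y z = (\<lambda>n. y n + z n)"
    "plus_in (lp_space (*) p) s t = (\<lambda>n. s n + t n)"
    "scale_in (lp_space smul p) c y = (\<lambda>n. smul c (y n))"
    "scale_in (lp_space (*) p) c t = (\<lambda>n. c * t n)"
    for y z :: "int \<Rightarrow> 'x" and s t :: "int \<Rightarrow> 'k" and c
    by (simp_all add: lp_space_def)
  ultimately show ?thesis
    unfolding bounded_operator_def power_space_def
    by (auto simp: scale_left_distrib sum.distrib scale_sum_right)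
qed

section \<open>Shifts of operators with a common eigenbasis\<close>

text \<open>
  The conjugating map \<open>H\<close> takes coordinates term by term, and its inverse \<open>G\<close> forms the
  corresponding linear combinations. A linear map with eigenbasis \<open>h\<close> multiplies each
  coordinate by its eigenvalue, and this is all that \<open>H\<close> needs to intertwine the shifts.
\<close>

lemma (in banach_space_over) conjugate_shift_if_common_eigenbasis:
  assumes p: "1 \<le> p"
    and B: "independent B" "span B = UNIV" and h: "bij_betw h {..<d} B"
    and S: "\<And>n. Vector_Spaces.linear smul smul (S n)"
    and eigen: "\<And>n i. i < d \<Longrightarrow> S n (h i) = smul (w i n) (h i)"
    and C: "0 \<le> C" "\<And>n x. norm (S n x) \<le> C * norm x"
    and wC: "\<And>i n. i < d \<Longrightarrow> norm (w i n) \<le> C"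
  shows "conjugate (lp_space smul p) (shift_operator S) (power_space d (lp_space (*) p))
    (product_operator d (\<lambda>i. weighted_backward_shift (w i)))"
proof -
  define coord where "coord i x = representation B x (h i)" for i x
  define H where "H x = (\<lambda>i\<in>{..<d}. \<lambda>n. coord i (x n))" for x :: "int \<Rightarrow> 'x"
  define G where "G f = (\<lambda>n. \<Sum>i<d. smul (f i n) (h i))" for f :: "nat \<Rightarrow> int \<Rightarrow> 'k"
  have "finite B"
    using h bij_betw_finite by blast
  then obtain K where "K \<ge> 0" and K: "\<And>x i. i < d \<Longrightarrow> norm (coord i x) \<le> K * norm x"
    using coordinates_bounded[OF _ B] h unfolding coord_def
    by (metis bij_betwE lessThan_iff)
  have coord_add: "coord i (x + y) = coord i x + coord i y" for i x y
    by (simp add: coord_def representation_add B)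
  have coord_scale: "coord i (smul c x) = c * coord i x" for i c x
    by (simp add: coord_def representation_scale B)
  have coord_sum: "coord i (\<Sum>j\<in>I. x j) = (\<Sum>j\<in>I. coord i (x j))" for i x and I :: "nat set"
    by (simp add: coord_def representation_sum B)
  have expand: "(\<Sum>i<d. smul (coord i x) (h i)) = x" for x
    unfolding coord_def sum.reindex_bij_betw[OF h, of "\<lambda>b. smul (representation B x b) b"]
    using B \<open>finite B\<close> by (intro sum_representation_eq) auto
  have coord_h: "coord i (h j) = (if j = i then 1 else 0)" if "i < d" "j < d" for i j
    using that h unfolding coord_def
    by (subst representation_basis) (auto simp: B bij_betw_def inj_on_def)
  have coord_G: "coord i (\<Sum>j<d. smul (c j) (h j)) = c i" if "i < d" for i c
    using that
    by (simp add: coord_sum coord_scale coord_h if_distrib[of "\<lambda>t. _ * t"] cong: if_cong)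
  have coord_S: "coord i (S n x) = w i n * coord i x" if "i < d" for i n x
  proof -
    interpret Sn: Vector_Spaces.linear smul smul "S n"
      by (rule S)
    have "S n x = S n (\<Sum>j<d. smul (coord j x) (h j))"
      by (simp only: expand)
    also have "\<dots> = (\<Sum>j<d. smul (w j n * coord j x) (h j))"
      by (simp add: Sn.sum Sn.scale eigen mult.commute)
    finally show ?thesis
      using coord_G[OF that] by simp
  qed

  have "bounded_operator (lp_space smul p) (lp_space smul p) (shift_operator S)"
  proof -
    have "S n (x + y) = S n x + S n y" and "S n (smul c x) = smul c (S n x)" for n c x y
      using S[of n] by (simp_all add: Vector_Spaces.linear_iff)
    then show ?thesis
      using bounded_operator_termwise[of p C "\<lambda>n. S (n + 1)" smul smul 1] p C
      by (simp add: shift_operator_def[abs_def])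
  qed
  moreover have "bounded_operator (power_space d (lp_space (*) p)) (power_space d (lp_space (*) p))
      (product_operator d (\<lambda>i. weighted_backward_shift (w i)))"
  proof (intro bounded_operator_product norm_in_lp_nonneg)
    fix i
    assume "i < d"
    then show "bounded_operator (lp_space (*) p) (lp_space (*) p) (weighted_backward_shift (w i))"
      using bounded_operator_termwise[of p C "\<lambda>n t. w i (n + 1) * t" "(*)" "(*)" 1] p C wC
      by (simp add: weighted_backward_shift_def[abs_def] distrib_left norm_mult mult_right_mono
          mult.left_commute)
  qed
  moreover have "bounded_operator (lp_space smul p) (power_space d (lp_space (*) p)) H"
    unfolding H_def
  proof (intro bounded_operator_into_power norm_in_lp_nonneg)
    fix i
    assume "i < d"
    then show "bounded_operator (lp_space smul p) (lp_space (*) p) (\<lambda>x n. coord i (x n))"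
      using bounded_operator_termwise[of p K "\<lambda>n. coord i" smul "(*)" 0] p K \<open>K \<ge> 0\<close>
      by (simp add: coord_add coord_scale)
  qed
  moreover have "bounded_operator (power_space d (lp_space (*) p)) (lp_space smul p) G"
    unfolding G_def using p by (rule bounded_operator_synthesis)
  moreover have "G (H x) = x" for x
    by (simp add: G_def H_def expand)
  moreover have "H (G f) = f" if "f \<in> vectors (power_space d (lp_space (*) p))" for f
  proof -
    have "H (G f) = restrict f {..<d}"
      by (auto simp: H_def G_def coord_G intro!: restrict_ext)
    then show ?thesis
      using that by (simp add: power_space_def PiE_restrict)
  qed
  moreover have "H (shift_operator S x)
      = product_operator d (\<lambda>i. weighted_backward_shift (w i)) (H x)" for x
    by (auto simp: H_def product_operator_def shift_operator_def weighted_backward_shift_def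
        coord_S intro!: restrict_ext)
  ultimately show ?thesis
    unfolding conjugate_def by blast
qed

theorem proposition3p5:
  fixes smul :: "'k::real_or_complex \<Rightarrow> 'x::banach \<Rightarrow> 'x"
    and S :: "int \<Rightarrow> 'x \<Rightarrow> 'x"
    and E :: "'x set"
    and d :: nat
    and p :: real
  assumes "banach_space_over smul"
    and "vector_space.dim smul (UNIV :: 'x set) = d" and "1 \<le> d"
    and "1 \<le> p"
    and "\<And>n. Vector_Spaces.linear smul smul (S n) \<and> bij (S n)"
    and "\<exists>C>0. \<forall>n. onorm (S n) < C \<and> onorm (inv (S n)) < C"
    and "basis_of smul E"
    and "jointly_diagonalizable smul E S"
  shows "\<exists>w :: nat \<Rightarrow> int \<Rightarrow> 'k.
           (\<forall>i<d. weight_sequence (w i)) \<and>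
           conjugate (lp_space smul p) (shift_operator S)
             (power_space d (lp_space (*) p))
             (product_operator d (\<lambda>i. weighted_backward_shift (w i)))"
proof -
  interpret banach_space_over smul
    by (rule assms(1))
  have lin: "Vector_Spaces.linear smul smul (S n)" and bij: "bij (S n)" for n
    using assms(5) by auto
  have E: "independent E" "span E = UNIV"
    using assms(7) by (simp_all add: basis_of_def)
  have card_E: "card E = d"
    using dim_eq_card[of E UNIV] E assms(2) by simp
  \<comment> \<open>An infinite set has cardinality 0, so \<open>d \<ge> 1\<close> makes the basis finite.\<close>
  then have "finite E"
    using \<open>1 \<le> d\<close> by (metis card.infinite not_one_le_zero)

  obtain L where L: "Vector_Spaces.linear smul smul L" "bij L"
    and "\<forall>n. \<exists>D. diagonal_operator smul E D \<and> S n = L \<circ> D \<circ> inv L"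
    using assms(8) unfolding jointly_diagonalizable_def by blast
  then obtain D where D: "\<And>n. diagonal_operator smul E (D n)"
    and SD: "\<And>n. S n = L \<circ> D n \<circ> inv L"
    by metis
  interpret L: Vector_Spaces.linear smul smul L
    by (rule L)
  define B where "B = L ` E"
  have B: "independent B" "span B = UNIV"
    unfolding B_def using L E
    by (auto simp: L.span_image bij_is_surj intro!: L.independent_injective_image[OF E(1)]
        intro: inj_on_subset[OF bij_is_inj])
  have "finite B"
    using \<open>finite E\<close> by (simp add: B_def)
  have "card B = d"
    unfolding B_def using card_E card_image[OF inj_on_subset[OF bij_is_inj[OF L(2)]]] by auto
  then obtain h where h: "bij_betw h {..<d} B"
    using ex_bij_betw_nat_finite[OF \<open>finite B\<close>] by (auto simp: atLeast0LessThan)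
  have h_nonzero: "h i \<noteq> 0" if "i < d" for i
    using that h B(1) dependent_zero by (metis bij_betwE lessThan_iff)

  have "\<exists>c. S n b = smul c b" if b: "b \<in> B" for n b
  proof -
    obtain e where e: "e \<in> E" "b = L e"
      using b by (auto simp: B_def)
    then obtain c where "D n e = smul c e"
      using D unfolding diagonal_operator_def by blast
    then have "S n b = smul c b"
      using L by (simp add: SD e bij_is_inj L.scale)
    then show ?thesis ..
  qed
  then have "\<forall>i n. \<exists>c. i < d \<longrightarrow> S n (h i) = smul c (h i)"
    using h by (metis bij_betwE lessThan_iff)
  then obtain w where w: "\<And>i n. i < d \<Longrightarrow> S n (h i) = smul (w i n) (h i)"
    by metis

  obtain C where "C > 0" and on: "\<And>n. onorm (S n) < C" "\<And>n. onorm (inv (S n)) < C"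
    using assms(6) by blast
  have lin_inv: "Vector_Spaces.linear smul smul (inv (S n))" for n
  proof -
    interpret Sn: Vector_Spaces.linear smul smul "S n"
      by (rule lin)
    have inv: "S n (inv (S n) x) = x" "inv (S n) (S n x) = x" for x
      using bij[of n] by (simp_all add: bij_is_surj bij_is_inj surj_f_inv_f)
    have "inv (S n) (x + y) = inv (S n) x + inv (S n) y"
      and "inv (S n) (smul c x) = smul c (inv (S n) x)" for x y c
      by (metis inv Sn.add, metis inv Sn.scale)
    then show ?thesis
      using lin[of n] by (simp add: Vector_Spaces.linear_iff)
  qed
  \<comment> \<open>The operators are bounded by finite dimension, so \<open>onorm\<close> is their operator norm.\<close>
  have SC: "norm (S n x) \<le> C * norm x" for n x
    using onorm[OF bounded_linear_finite_dimensional[OF \<open>finite B\<close> B lin], of n x] on(1)[of n]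
    by (meson less_imp_le mult_right_mono norm_ge_zero order_trans)
  have SC': "norm (inv (S n) x) \<le> C * norm x" for n x
    using onorm[OF bounded_linear_finite_dimensional[OF \<open>finite B\<close> B lin_inv], of n x] on(2)[of n]
    by (meson less_imp_le mult_right_mono norm_ge_zero order_trans)

  have w_le: "norm (w i n) \<le> C" if "i < d" for i n
    using SC[of n "h i"] h_nonzero[OF that] by (simp add: w[OF that] norm_scale)
  have w_ge: "1 / C \<le> norm (w i n)" if "i < d" for i n
  proof -
    have "inv (S n) (smul (w i n) (h i)) = h i"
      using w[OF that, of n] bij[of n] by (metis bij_inv_eq_iff)
    then have "norm (h i) \<le> C * (norm (w i n) * norm (h i))"
      using SC'[of n "smul (w i n) (h i)"] by (simp add: norm_scale)
    then have "1 * norm (h i) \<le> (C * norm (w i n)) * norm (h i)"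
      by (simp add: mult.assoc)
    then have "1 \<le> C * norm (w i n)"
      using h_nonzero[OF that] by (simp only: mult_le_cancel_right zero_less_norm_iff) auto
    then show ?thesis
      using \<open>C > 0\<close> by (simp add: pos_divide_le_eq mult.commute)
  qed
  have "weight_sequence (w i)" if "i < d" for i
    unfolding weight_sequence_def
    using w_le[OF that] w_ge[OF that] \<open>C > 0\<close> by (intro exI[of _ "1 / C"]) auto
  moreover have "conjugate (lp_space smul p) (shift_operator S)
      (power_space d (lp_space (*) p)) (product_operator d (\<lambda>i. weighted_backward_shift (w i)))"
    using \<open>C > 0\<close>
    by (intro conjugate_shift_if_common_eigenbasis[OF \<open>1 \<le> p\<close> B h lin w _ SC w_le]) auto
  ultimately show ?thesis
    by blast
qed

end
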